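(* Let $(\mathcal{G},p)$ be a local-relative-measurement-based network in $\mathbb{R}^3$ with anchor nodes $\mathcal{V}_a$ and free nodes $\mathcal{V}_f$, and assume: no two nodes are collocated; each anchor node has at least two neighboring anchor nodes; each free node has at least four neighboring nodes; and, when the measurements are local relative bearings or angles, each free node and its neighbors are non-colinear. Then $(\mathcal{G},p)$ is localizable if and only if the matrix $D_{ff}$ is nonsingular. In this situation, the true positions of the free nodes are $p_f=-D_{ff}^{-1}D_{fa}p_a$.
   Context: $\mathcal{G}=(\mathcal{V},\mathcal{E})$ is an undirected graph with $\mathcal{V}=\{1,\dots,n\}$, and $p=(p_1^T,\dots,p_n^T)^T\in\mathbb{R}^{3n}$. Anchor nodes $\mathcal{V}_a=\{1,\dots,n_a\}$ have known positions $p_a=(p_1^T,\dots,p_{n_a}^T)^T$; free nodes $\mathcal{V}_f=\{n_a+1,\dots,n\}$, $n_f=n-n_a$, have unknown positions $p_f=(p_{n_a+1}^T,\dots,p_n^T)^T$. For $x\in\mathbb{R}^{3n}$ write $e_{ij}(x)=x_j-x_i$. Displacement constraints. $\mathcal{X}_{\mathcal{G}}$ is the set of 5-tuples for which displacement constraints are constructed from the local relative measurements (all of one type: local relative position, distance, local relative bearing, angle, or ratio-of-distance). It consists of 5-tuples $(i,j,k,h,l)$ with $(i,j),(i,k),(i,h),(i,l)\in\mathcal{E}$, $j<k<h<l$ (all such tuples for local relative position measurements; in general a subset). Each tuple comes with a fixed nonzero vector $(\mu_{ij},\mu_{ik},\mu_{ih},\mu_{il})\in\mathbb{R}^4$ (obtained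 from the measurements) with $\mu_{ij}e_{ij}(p)+\mu_{ik}e_{ik}(p)+\mu_{ih}e_{ih}(p)+\mu_{il}e_{il}(p)=\mathbf{0}$. Angle constraints (only among anchors). $\Upsilon_{\mathcal{G}}$ is the set of triples $(i,j,k)$ of anchor nodes with $i<j<k$ and $(i,j),(i,k),(j,k)\in\mathcal{E}$. With $a=e_{ik}(p)^Te_{ij}(p)$, $b=e_{ki}(p)^Te_{kj}(p)$, put $(w_{ik},w_{ki})=(1/a,-1/b)$ if $a,b\neq0$; $(1,0)$ if $a=0,b\ne0$; $(0,1)$ if $a\neq0,b=0$; $(1,1)$ if $a=b=0$; so $w_{ik}e_{ik}(p)^Te_{ij}(p)+w_{ki}e_{ki}(p)^Te_{kj}(p)=0$. With all coefficients held fixed, the angle-displacement function $f(x)$ stacks the scalars $w_{ik}e_{ik}(x)^Te_{ij}(x)+w_{ki}e_{ki}(x)^Te_{kj}(x)$ over $\Upsilon_{\mathcal{G}}$ and the vectors $\mu_{ij}e_{ij}(x)+\mu_{ik}e_{ik}(x)+\mu_{ih}e_{ih}(x)+\mu_{il}e_{il}(x)$ over $\mathcal{X}_{\mathcal{G}}$. The rigidity matrix is $R(p)=\partial f(x)/\partial x|_{x=p}$, and the angle-displacement information matrix is $D=R(p)^TR(p)=\begin{pmatrix}D_{aa}&D_{af}\\ D_{fa}&D_{ff}\end{pmatrix}$, partitioned according to anchors ($3n_a$) and free nodes ($3n_f$). Localizability. $(\mathcal{G},p)$ is localizable if $\hat p=p$ is the unique $\hat p\in\mathbb{R}^{3n}$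 with $\hat p_i=p_i$ for all $i\in\mathcal{V}_a$ and $\mu_{ij}e_{ij}(\hat p)+\mu_{ik}e_{ik}(\hat p)+\mu_{ih}e_{ih}(\hat p)+\mu_{il}e_{il}(\hat p)=\mathbf{0}$ for all $(i,j,k,h,l)\in\mathcal{X}_{\mathcal{G}}$. *)

theory Defs
  imports
    "HOL-Analysis.Analysis"
    "Jordan_Normal_Form.Matrix"
    "Jordan_Normal_Form.Gauss_Jordan_Elimination"
begin

no_notation Matrix.scalar_prod (infix "\<bullet>" 70)
no_notation Matrix.vec_index (infixl "$" 100)

datatype measurement =
  Relative_Position | Distance | Relative_Bearing | Angle | Ratio_Of_Distance

type_synonym graph = "(nat \<times> nat) set"

text \<open>The nodes are \<open>1, \<dots>, n\<close>, the anchors are \<open>1, \<dots>, na\<close>. An undirected graph is given by its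
  symmetric, loop-free adjacency relation.\<close>

definition undirected_graph :: "nat \<Rightarrow> graph \<Rightarrow> bool" where
  "undirected_graph n E \<longleftrightarrow> E \<subseteq> {1..n} \<times> {1..n} \<and> sym E \<and> irrefl E"

definition neighbors :: "graph \<Rightarrow> nat \<Rightarrow> nat set" where
  "neighbors E i = {j. (i, j) \<in> E}"

text \<open>A configuration is a stacked vector of dimension \<open>3 * n\<close>. Its entries are numbered from 0,
  so node \<open>i\<close> occupies the entries \<open>3 * (i - 1), \<dots>, 3 * (i - 1) + 2\<close>.\<close>

definition pos :: "real Matrix.vec \<Rightarrow> nat \<Rightarrow> real ^ 3" where
  "pos x i = vector [vec_index x (3 * (i - 1)),
                     vec_index x (3 * (i - 1) + 1),
                     vec_index x (3 * (i - 1) + 2)]"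

definition edge :: "real Matrix.vec \<Rightarrow> nat \<Rightarrow> nat \<Rightarrow> real ^ 3" where
  "edge x i j = pos x j - pos x i"

subsection \<open>Displacement constraints\<close>

type_synonym tuple5 = "nat \<times> nat \<times> nat \<times> nat \<times> nat"

definition displacement_tuples :: "graph \<Rightarrow> tuple5 set" where
  "displacement_tuples E =
     {(i, j, k, h, l). (i, j) \<in> E \<and> (i, k) \<in> E \<and> (i, h) \<in> E \<and> (i, l) \<in> E
        \<and> j < k \<and> k < h \<and> h < l}"

text \<open>The four coefficients \<open>(\<mu>\<^sub>i\<^sub>j, \<mu>\<^sub>i\<^sub>k, \<mu>\<^sub>i\<^sub>h, \<mu>\<^sub>i\<^sub>l)\<close> belong to the tuple, not to the individual edges.\<close>

fun displacement :: "(tuple5 \<Rightarrow> real ^ 4) \<Rightarrow> real Matrix.vec \<Rightarrow> tuple5 \<Rightarrow> real ^ 3" where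
  "displacement \<mu> x (i, j, k, h, l) =
     (\<mu> (i, j, k, h, l) $ 1) *\<^sub>R edge x i j + (\<mu> (i, j, k, h, l) $ 2) *\<^sub>R edge x i k
   + (\<mu> (i, j, k, h, l) $ 3) *\<^sub>R edge x i h + (\<mu> (i, j, k, h, l) $ 4) *\<^sub>R edge x i l"

definition displacement_data ::
  "measurement \<Rightarrow> graph \<Rightarrow> tuple5 set \<Rightarrow> (tuple5 \<Rightarrow> real ^ 4) \<Rightarrow> real Matrix.vec \<Rightarrow> bool" where
  "displacement_data m E X \<mu> p \<longleftrightarrow>
     X \<subseteq> displacement_tuples E
   \<and> (m = Relative_Position \<longrightarrow> X = displacement_tuples E)
   \<and> (\<forall>t\<in>X. \<mu> t \<noteq> 0 \<and> displacement \<mu> p t = 0)"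

subsection \<open>Angle constraints among anchors\<close>

definition angle_triples :: "nat \<Rightarrow> graph \<Rightarrow> (nat \<times> nat \<times> nat) set" where
  "angle_triples na E =
     {(i, j, k). {i, j, k} \<subseteq> {1..na} \<and> i < j \<and> j < k
        \<and> (i, j) \<in> E \<and> (i, k) \<in> E \<and> (j, k) \<in> E}"

definition angle_weights :: "real Matrix.vec \<Rightarrow> nat \<times> nat \<times> nat \<Rightarrow> real \<times> real" where
  "angle_weights p = (\<lambda>(i, j, k).
     let a = edge p i k \<bullet> edge p i j; b = edge p k i \<bullet> edge p k j
     in if a \<noteq> 0 \<and> b \<noteq> 0 then (1 / a, - 1 / b)
        else if a = 0 \<and> b \<noteq> 0 then (1, 0)
        else if a \<noteq> 0 \<and> b = 0 then (0, 1)
        else (1, 1))"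

text \<open>The weights are computed at \<open>p\<close> and stay fixed while \<open>x\<close> varies.\<close>

fun angle_value :: "real Matrix.vec \<Rightarrow> real Matrix.vec \<Rightarrow> nat \<times> nat \<times> nat \<Rightarrow> real" where
  "angle_value p x (i, j, k) =
     fst (angle_weights p (i, j, k)) * (edge x i k \<bullet> edge x i j)
   + snd (angle_weights p (i, j, k)) * (edge x k i \<bullet> edge x k j)"

subsection \<open>Rigidity matrix and information matrix\<close>

text \<open>A fixed ordering of a finite index set, used for stacking. The choice only permutes the rows
  of the rigidity matrix \<open>R\<close> and does not affect \<open>R\<^sup>T R\<close>.\<close>

definition enumeration :: "'a set \<Rightarrow> 'a list" where
  "enumeration A = (SOME xs. set xs = A \<and> distinct xs)"

definition angle_displacement_function ::
  "nat \<Rightarrow> graph \<Rightarrow> tuple5 set \<Rightarrow> (tuple5 \<Rightarrow> real ^ 4) \<Rightarrow> real Matrix.vec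
     \<Rightarrow> real Matrix.vec \<Rightarrow> real Matrix.vec" where
  "angle_displacement_function na E X \<mu> p x = vec_of_list
     (map (angle_value p x) (enumeration (angle_triples na E))
      @ concat (map (\<lambda>t. [displacement \<mu> x t $ 1, displacement \<mu> x t $ 2, displacement \<mu> x t $ 3])
                    (enumeration X)))"

text \<open>The matrix of partial derivatives of a map between stacked vectors.\<close>

definition jacobian :: "(real Matrix.vec \<Rightarrow> real Matrix.vec) \<Rightarrow> real Matrix.vec \<Rightarrow> real mat" where
  "jacobian f x = Matrix.mat (dim_vec (f x)) (dim_vec x)
     (\<lambda>(r, c). deriv (\<lambda>t. vec_index (f (x |\<^sub>v c \<mapsto> t)) r) (vec_index x c))"

definition rigidity_matrix ::
  "nat \<Rightarrow> graph \<Rightarrow> tuple5 set \<Rightarrow> (tuple5 \<Rightarrow> real ^ 4) \<Rightarrow> real Matrix.vec \<Rightarrow> real mat" where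
  "rigidity_matrix na E X \<mu> p = jacobian (angle_displacement_function na E X \<mu> p) p"

definition information_matrix ::
  "nat \<Rightarrow> graph \<Rightarrow> tuple5 set \<Rightarrow> (tuple5 \<Rightarrow> real ^ 4) \<Rightarrow> real Matrix.vec \<Rightarrow> real mat" where
  "information_matrix na E X \<mu> p =
     transpose_mat (rigidity_matrix na E X \<mu> p) * rigidity_matrix na E X \<mu> p"

definition block_fa :: "nat \<Rightarrow> 'a mat \<Rightarrow> 'a mat" where
  "block_fa na D = (case split_block D (3 * na) (3 * na) of (Daa, Daf, Dfa, Dff) \<Rightarrow> Dfa)"

definition block_ff :: "nat \<Rightarrow> 'a mat \<Rightarrow> 'a mat" where
  "block_ff na D = (case split_block D (3 * na) (3 * na) of (Daa, Daf, Dfa, Dff) \<Rightarrow> Dff)"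

subsection \<open>Localizability\<close>

definition localizable ::
  "nat \<Rightarrow> nat \<Rightarrow> tuple5 set \<Rightarrow> (tuple5 \<Rightarrow> real ^ 4) \<Rightarrow> real Matrix.vec \<Rightarrow> bool" where
  "localizable n na X \<mu> p \<longleftrightarrow>
     {q \<in> carrier_vec (3 * n). (\<forall>i\<in>{1..na}. pos q i = pos p i) \<and> (\<forall>t\<in>X. displacement \<mu> q t = 0)}
       = {p}"

end

theory Submission
  imports Defs "Jordan_Normal_Form.Determinant"
begin

text \<open>An angle row of \<open>R\<close> vanishes on the columns of the free nodes, and a displacement row is a
  linear form that vanishes at \<open>p\<close>. Since \<open>D = R\<^sup>T R\<close>, the kernel of \<open>D\<^sub>f\<^sub>f\<close> consists of the \<open>v\<close> with
  \<open>R (0, v) = 0\<close>, that is, of the differences between \<open>p\<close> and the other solutions of the displacement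
  constraints with the same anchors. The two kinds of rows also give \<open>(R\<^sup>T R p)\<^sub>f = 0\<close>, row by row,
  which is \<open>D\<^sub>f\<^sub>a p\<^sub>a + D\<^sub>f\<^sub>f p\<^sub>f = 0\<close>.\<close>

no_notation Matrix.scalar_prod (infix "\<bullet>" 70)
no_notation Matrix.vec_index (infixl "$" 100)

section \<open>Invertibility of square matrices through kernels and determinants\<close>

lemma invertible_mat_iff_kernel:
  fixes A :: "'a :: field mat"
  assumes A: "A \<in> carrier_mat n n"
  shows "invertible_mat A \<longleftrightarrow> (\<forall>v\<in>carrier_vec n. A *\<^sub>v v = 0\<^sub>v n \<longrightarrow> v = 0\<^sub>v n)"
proof
  assume "invertible_mat A"
  then obtain B where AB: "A * B = 1\<^sub>m n" and BA: "B * A = 1\<^sub>m (dim_row B)"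
    using A by (auto simp: invertible_mat_def inverts_mat_def)
  \<comment> \<open>\<open>inverts_mat\<close> does not fix the shape of \<open>B\<close>; it is
    read off from the dimensions of the two products.\<close>
  have "dim_row B = dim_col (B * A)"
    using BA by simp
  moreover have "dim_col B = dim_col (A * B)"
    by simp
  ultimately have B: "B \<in> carrier_mat n n"
    using A AB by auto
  show "\<forall>v\<in>carrier_vec n. A *\<^sub>v v = 0\<^sub>v n \<longrightarrow> v = 0\<^sub>v n"
  proof (intro ballI impI)
    fix v :: "'a Matrix.vec"
    assume v: "v \<in> carrier_vec n" and "A *\<^sub>v v = 0\<^sub>v n"
    then have "(B * A) *\<^sub>v v = 0\<^sub>v n"
      using A B by auto
    then show "v = 0\<^sub>v n"
      using BA B v by simp
  qed
next
  assume "\<forall>v\<in>carrier_vec n. A *\<^sub>v v = 0\<^sub>v n \<longrightarrow> v = 0\<^sub>v n"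
  \<comment> \<open>The determinant turns a trivial kernel into a two-sided inverse: a zero
    determinant would give a nonzero kernel vector.\<close>
  then have "Determinant.det A \<noteq> 0"
    using det_0_iff_vec_prod_zero[OF A] by auto
  from det_non_zero_imp_unit[OF A this, where b = "()"] obtain B
    where "B \<in> carrier_mat n n" "B * A = 1\<^sub>m n" "A * B = 1\<^sub>m n"
    by (auto simp: Units_def ring_mat_def)
  then show "invertible_mat A"
    using A by (auto simp: invertible_mat_def inverts_mat_def)
qed

text \<open>\<open>mat_inverse\<close> returns an option, and \<open>None\<close> would mean that
  \<open>A\<close> is not a unit of the matrix ring. A nonzero determinant excludes this, so
  \<open>the\<close> is applied to a proper value.\<close>

lemma mat_inverse_invertible:
  fixes A :: "'a :: field mat"
  assumes A: "A \<in> carrier_mat n n" and inv: "invertible_mat A"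
  shows "the (mat_inverse A) \<in> carrier_mat n n" and "the (mat_inverse A) * A = 1\<^sub>m n"
proof -
  have "Determinant.det A \<noteq> 0"
    using inv det_0_iff_vec_prod_zero[OF A] invertible_mat_iff_kernel[OF A] by auto
  from det_non_zero_imp_unit[OF A this, where b = "()"] mat_inverse(1)[OF A, where b = "()"]
  obtain B where "mat_inverse A = Some B"
    by (cases "mat_inverse A") auto
  then show "the (mat_inverse A) \<in> carrier_mat n n" "the (mat_inverse A) * A = 1\<^sub>m n"
    using mat_inverse(2)[OF A] by auto
qed

lemma mult_mat_zero_vec:
  fixes A :: "'a :: semiring_0 mat"
  shows "A \<in> carrier_mat m n \<Longrightarrow> A *\<^sub>v 0\<^sub>v n = 0\<^sub>v m"
  by (intro eq_vecI) auto

section \<open>The anchor/free block partition and the kernel of a diagonal Gram block\<close>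

lemma block_carrier:
  assumes "D \<in> carrier_mat (3 * na + k) (3 * na + k)"
  shows "block_ff na D \<in> carrier_mat k k" and "block_fa na D \<in> carrier_mat k (3 * na)"
  using assms by (auto simp: block_ff_def block_fa_def split_block_def Let_def)

text \<open>Row \<open>3 * na + i\<close> of \<open>D\<close> is row \<open>i\<close> of the lower
  left block followed by row \<open>i\<close> of the lower right one, so its product with a split
  vector is a sum of two scalar products.\<close>

lemma block_mult_vec:
  fixes D :: "'a :: comm_semiring_0 mat"
  assumes D: "D \<in> carrier_mat (3 * na + k) (3 * na + k)"
    and u: "u \<in> carrier_vec (3 * na)" and w: "w \<in> carrier_vec k"
  shows "block_fa na D *\<^sub>v u + block_ff na D *\<^sub>v w = vec_last (D *\<^sub>v (u @\<^sub>v w)) k"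
proof (rule eq_vecI)
  fix i assume "i < dim_vec (vec_last (D *\<^sub>v (u @\<^sub>v w)) k)"
  then have i: "i < k" by simp
  have fa: "Matrix.row (block_fa na D) i = Matrix.vec (3 * na) (\<lambda>j. D $$ (i + 3 * na, j))"
    using D i by (auto simp: block_fa_def split_block_def Let_def)
  have ff: "Matrix.row (block_ff na D) i = Matrix.vec k (\<lambda>j. D $$ (i + 3 * na, j + 3 * na))"
    using D i by (auto simp: block_ff_def split_block_def Let_def)
  have "Matrix.row D (i + 3 * na) = Matrix.row (block_fa na D) i @\<^sub>v Matrix.row (block_ff na D) i"
    unfolding fa ff using D i by (intro eq_vecI) auto
  then have "scalar_prod (Matrix.row D (i + 3 * na)) (u @\<^sub>v w)
      = scalar_prod (Matrix.row (block_fa na D) i) u + scalar_prod (Matrix.row (block_ff na D) i) w"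
    using u w by (simp add: scalar_prod_append[where ?n1.0 = "3 * na" and ?n2.0 = k] fa ff)
  then show "vec_index (block_fa na D *\<^sub>v u + block_ff na D *\<^sub>v w) i
      = vec_index (vec_last (D *\<^sub>v (u @\<^sub>v w)) k) i"
    using D i block_carrier[OF D] by (auto simp: vec_last_def add.commute)
qed (use block_carrier[OF D] in auto)

text \<open>For \<open>x = (0, w)\<close> the quadratic form of the block at \<open>w\<close> equals
  that of the whole Gram matrix at \<open>x\<close>, which is the squared norm of
  \<open>R x\<close>. Hence a kernel vector of the block already satisfies
  \<open>R x = 0\<close>.\<close>

lemma gram_block_kernel:
  fixes R :: "real mat"
  assumes R: "R \<in> carrier_mat N (3 * na + k)" and w: "w \<in> carrier_vec k"
  shows "block_ff na (transpose_mat R * R) *\<^sub>v w = 0\<^sub>v k \<longleftrightarrow> R *\<^sub>v (0\<^sub>v (3 * na) @\<^sub>v w) = 0\<^sub>v N"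
proof -
  let ?D = "transpose_mat R * R" and ?x = "0\<^sub>v (3 * na) @\<^sub>v w"
  have D: "?D \<in> carrier_mat (3 * na + k) (3 * na + k)" and x: "?x \<in> carrier_vec (3 * na + k)"
    using R w by auto
  have Dx: "?D *\<^sub>v ?x = transpose_mat R *\<^sub>v (R *\<^sub>v ?x)"
    using R x by (intro assoc_mult_mat_vec) auto
  have last: "block_ff na ?D *\<^sub>v w = vec_last (?D *\<^sub>v ?x) k"
    using block_mult_vec[OF D zero_carrier_vec w] mult_mat_vec_carrier[OF block_carrier(1)[OF D] w]
    by (simp add: mult_mat_zero_vec[OF block_carrier(2)[OF D]])
  show ?thesis
  proof
    assume "block_ff na ?D *\<^sub>v w = 0\<^sub>v k"
    \<comment> \<open>Nothing is known about the first \<open>3 * na\<close> entries of the product,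
      but in the scalar product they meet the zeros of \<open>?x\<close>.\<close>
    then have "vec_first (?D *\<^sub>v ?x) (3 * na) @\<^sub>v 0\<^sub>v k = ?D *\<^sub>v ?x"
      using last vec_first_last_append[OF mult_mat_vec_carrier[OF D x]] by simp
    then have "scalar_prod ?x (?D *\<^sub>v ?x) = scalar_prod ?x (vec_first (?D *\<^sub>v ?x) (3 * na) @\<^sub>v 0\<^sub>v k)"
      by simp
    also have "\<dots> = 0"
      using w by (subst scalar_prod_append[where ?n1.0 = "3 * na" and ?n2.0 = k]) auto
    finally have "scalar_prod (?D *\<^sub>v ?x) ?x = 0"
      using comm_scalar_prod[OF mult_mat_vec_carrier[OF D x] x] by simp
    then have "scalar_prod (R *\<^sub>v ?x) (R *\<^sub>v ?x) = 0"
      using R x Dx by (simp add: transpose_vec_mult_scalar[of R N "3 * na + k"])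
    then show "R *\<^sub>v ?x = 0\<^sub>v N"
      using conjugate_square_eq_0_vec[of "R *\<^sub>v ?x" N] R x by simp
  next
    assume "R *\<^sub>v ?x = 0\<^sub>v N"
    then show "block_ff na ?D *\<^sub>v w = 0\<^sub>v k"
      unfolding last Dx using R mult_mat_zero_vec[of "transpose_mat R" "3 * na + k" N]
      by (intro eq_vecI) (auto simp: vec_last_def)
  qed
qed

section \<open>Linear forms on stacked configurations\<close>

text \<open>Equality is asked only on \<open>carrier_vec N\<close>, since \<open>pos\<close> may
  read entries outside a shorter vector. The coefficient vector stays existential here and later
  turns out to be a row of the Jacobian.\<close>

definition linear_form :: "nat \<Rightarrow> (real Matrix.vec \<Rightarrow> real) \<Rightarrow> bool" where
  "linear_form N g \<longleftrightarrow> (\<exists>a\<in>carrier_vec N. \<forall>x\<in>carrier_vec N. g x = scalar_prod a x)"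

lemma linear_form_coordinate: "c < N \<Longrightarrow> linear_form N (\<lambda>x. vec_index x c)"
  unfolding linear_form_def by (rule bexI[of _ "unit_vec N c"]) auto

lemma linear_form_add:
  assumes "linear_form N g" "linear_form N h"
  shows "linear_form N (\<lambda>x. g x + h x)"
proof -
  obtain a b where "a \<in> carrier_vec N" "\<forall>x\<in>carrier_vec N. g x = scalar_prod a x"
    and "b \<in> carrier_vec N" "\<forall>x\<in>carrier_vec N. h x = scalar_prod b x"
    using assms unfolding linear_form_def by blast
  then show ?thesis
    unfolding linear_form_def
    by (intro bexI[of _ "a + b"]) (auto simp: add_scalar_prod_distrib[of _ N])
qed

lemma linear_form_scale:
  assumes "linear_form N g"
  shows "linear_form N (\<lambda>x. c * g x)"
proof -
  obtain a where "a \<in> carrier_vec N" "\<forall>x\<in>carrier_vec N. g x = scalar_prod a x"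
    using assms unfolding linear_form_def by blast
  then show ?thesis
    unfolding linear_form_def by (intro bexI[of _ "c \<cdot>\<^sub>v a"]) auto
qed

lemma linear_form_diff:
  assumes "linear_form N g" "linear_form N h"
  shows "linear_form N (\<lambda>x. g x - h x)"
  using linear_form_add[OF assms(1) linear_form_scale[OF assms(2), of "- 1"]] by simp

lemma linear_form_apply_add:
  assumes "linear_form N g" "x \<in> carrier_vec N" "y \<in> carrier_vec N"
  shows "g (x + y) = g x + g y"
  using assms unfolding linear_form_def by (auto simp: scalar_prod_add_distrib[of _ N])

lemma linear_form_pos:
  assumes "i \<in> {1..n}"
  shows "linear_form (3 * n) (\<lambda>x. pos x i $ s)"
proof -
  have "\<forall>s. linear_form (3 * n) (\<lambda>x. pos x i $ s)"
    unfolding forall_3 pos_def vector_3 using assms by (auto intro!: linear_form_coordinate)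
  then show ?thesis ..
qed

lemma linear_form_displacement:
  assumes "undirected_graph n E" "t \<in> displacement_tuples E"
  shows "linear_form (3 * n) (\<lambda>x. displacement \<mu> x t $ s)"
proof -
  obtain i j k h l where t: "t = (i, j, k, h, l)"
    by (cases t) auto
  then have "{i, j, k, h, l} \<subseteq> {1..n}"
    using assms unfolding undirected_graph_def displacement_tuples_def by auto
  then show ?thesis
    unfolding t displacement.simps edge_def
    by (auto intro!: linear_form_add linear_form_diff linear_form_scale linear_form_pos)
qed

section \<open>Rows of the Jacobian: linear components, and components that depend on anchors
  only\<close>

lemma scalar_prod_update_vec:
  fixes a :: "real Matrix.vec"
  assumes "a \<in> carrier_vec N" "x \<in> carrier_vec N" "c < N"
  shows "scalar_prod a (x |\<^sub>v c \<mapsto> t) = scalar_prod a x + vec_index a c * (t - vec_index x c)"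
proof -
  have "(x |\<^sub>v c \<mapsto> t) = x + (t - vec_index x c) \<cdot>\<^sub>v unit_vec N c"
    using assms by (intro eq_vecI) (auto simp: update_vec_def unit_vec_def)
  then show ?thesis
    using assms by (simp add: scalar_prod_add_distrib[of _ N])
qed

text \<open>A linear form is its own derivative: along coordinate \<open>c\<close> it is affine with
  slope \<open>a\<close> at \<open>c\<close>, so row \<open>r\<close> is the coefficient vector.
  Linearity is asked of component \<open>r\<close> alone because the angle components of the stacked
  function are quadratic.\<close>

lemma jacobian_linear_row:
  assumes x: "x \<in> carrier_vec N" and dim: "r < dim_vec (f x)"
    and lin: "linear_form N (\<lambda>y. vec_index (f y) r)" and y: "y \<in> carrier_vec N"
  shows "vec_index (jacobian f x *\<^sub>v y) r = vec_index (f y) r"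
proof -
  obtain a where a: "a \<in> carrier_vec N"
    and fa: "\<And>y. y \<in> carrier_vec N \<Longrightarrow> vec_index (f y) r = scalar_prod a y"
    using lin unfolding linear_form_def by auto
  have "jacobian f x $$ (r, c) = vec_index a c" if c: "c < N" for c
  proof -
    have "vec_index (f (x |\<^sub>v c \<mapsto> t)) r = scalar_prod a x + vec_index a c * (t - vec_index x c)" for t
    proof -
      have "x |\<^sub>v c \<mapsto> t \<in> carrier_vec N"
        using x by (intro carrier_vecI) simp
      then show ?thesis
        by (simp only: fa scalar_prod_update_vec[OF a x c])
    qed
    moreover have "((\<lambda>t. scalar_prod a x + vec_index a c * (t - vec_index x c))
        has_field_derivative vec_index a c) (at (vec_index x c))"
      by (auto intro!: derivative_eq_intros)
    ultimately have "deriv (\<lambda>t. vec_index (f (x |\<^sub>v c \<mapsto> t)) r) (vec_index x c) = vec_index a c"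
      by (simp only: DERIV_imp_deriv)
    then show ?thesis
      using x c dim by (simp add: jacobian_def)
  qed
  then have "Matrix.row (jacobian f x) r = a"
    using a x dim by (intro eq_vecI) (simp_all add: jacobian_def)
  moreover have "r < dim_row (jacobian f x)"
    using dim by (simp add: jacobian_def)
  ultimately show ?thesis
    using y by (simp add: fa)
qed

lemma pos_update_vec:
  assumes "1 \<le> i" "i \<le> na" "3 * na \<le> c" "3 * na \<le> dim_vec x"
  shows "pos (x |\<^sub>v c \<mapsto> t) i = pos x i"
proof -
  have "vec_index (x |\<^sub>v c \<mapsto> t) d = vec_index x d" if "d < 3 * na" for d
    using that assms by (simp add: update_vec_def)
  then show ?thesis
    using assms unfolding pos_def by simp
qed

text \<open>The weights are computed at \<open>p\<close>, and all edges of the triple join anchors,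
  whose entries lie below \<open>3 * na\<close>. This makes the angle rows vanish on the free
  columns.\<close>

lemma angle_value_update_vec:
  assumes "t \<in> angle_triples na E" "3 * na \<le> c" "3 * na \<le> dim_vec x"
  shows "angle_value p (x |\<^sub>v c \<mapsto> s) t = angle_value p x t"
  using assms by (auto simp: angle_triples_def edge_def pos_update_vec[of _ na])

lemma set_enumeration: "finite A \<Longrightarrow> set (enumeration A) = A"
  unfolding enumeration_def using finite_distinct_list[of A] by (rule someI2_ex) auto

section \<open>Localizability as triviality of a kernel\<close>

lemma anchor_coordinates:
  assumes "\<forall>i\<in>{1..na}. pos x i = pos y i" "c < 3 * na"
  shows "vec_index x c = vec_index y c"
proof -
  \<comment> \<open>Nodes count from 1 and entries from 0, so entry \<open>c\<close> belongs to node
    \<open>c div 3 + 1\<close> at offset \<open>c mod 3\<close>.\<close>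
  have "pos x (c div 3 + 1) = pos y (c div 3 + 1)"
    using assms by auto
  then have *: "vec_index x (3 * (c div 3) + s) = vec_index y (3 * (c div 3) + s)" if "s \<in> {0, 1, 2}" for s
    using that unfolding pos_def Finite_Cartesian_Product.vec_eq_iff forall_3 vector_3 by auto
  have "c mod 3 \<in> {0, 1, 2}"
    by auto
  from *[OF this] show ?thesis
    by simp
qed

text \<open>Write a candidate as \<open>p + y\<close>. Agreement at the anchors means that
  \<open>y\<close> starts with \<open>3 * na\<close> zeros, and by additivity the candidate
  satisfies the displacement constraints exactly when \<open>y\<close> does.\<close>

lemma localizable_iff_kernel:
  assumes graph: "undirected_graph n E" and na: "na \<le> n" and p: "p \<in> carrier_vec (3 * n)"
    and data: "displacement_data m E X \<mu> p"
  shows "localizable n na X \<mu> p \<longleftrightarrow> (\<forall>v\<in>carrier_vec (3 * (n - na)).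
    (\<forall>t\<in>X. displacement \<mu> (0\<^sub>v (3 * na) @\<^sub>v v) t = 0) \<longrightarrow> v = 0\<^sub>v (3 * (n - na)))"
    (is "_ \<longleftrightarrow> (\<forall>v\<in>carrier_vec ?k. ?P v)")
proof -
  have n: "3 * n = 3 * na + ?k"
    using na by simp
  have disp_p: "displacement \<mu> p t = 0" if "t \<in> X" for t
    using data that by (auto simp: displacement_data_def)
  have disp_add: "displacement \<mu> (p + y) t = displacement \<mu> y t"
    if "y \<in> carrier_vec (3 * n)" "t \<in> X" for y t
  proof -
    have "t \<in> displacement_tuples E"
      using data that by (auto simp: displacement_data_def)
    then have "displacement \<mu> (p + y) t = displacement \<mu> p t + displacement \<mu> y t"
      unfolding Finite_Cartesian_Product.vec_eq_iff vector_add_component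
      using linear_form_apply_add[OF linear_form_displacement[OF graph] p] that by blast
    then show ?thesis
      using disp_p[OF that(2)] by simp
  qed
  show ?thesis
  proof
    assume loc: "localizable n na X \<mu> p"
    show "\<forall>v\<in>carrier_vec ?k. ?P v"
    proof (intro ballI impI)
      fix v :: "real Matrix.vec"
      assume v: "v \<in> carrier_vec ?k" and ker: "\<forall>t\<in>X. displacement \<mu> (0\<^sub>v (3 * na) @\<^sub>v v) t = 0"
      let ?y = "0\<^sub>v (3 * na) @\<^sub>v v"
      have y: "?y \<in> carrier_vec (3 * n)"
        unfolding n using v by auto
      have "pos (p + ?y) i = pos p i" if "i \<in> {1..na}" for i
      proof -
        have "vec_index (p + ?y) c = vec_index p c" if "c < 3 * na" for c
          using that v y by auto
        then show ?thesis
          using that unfolding pos_def by auto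
      qed
      moreover have "\<forall>t\<in>X. displacement \<mu> (p + ?y) t = 0"
        using ker disp_add[OF y] by simp
      moreover have "p + ?y \<in> carrier_vec (3 * n)"
        using p y by simp
      ultimately have "p + ?y \<in> {p}"
        using loc unfolding localizable_def by (elim equalityE) (rule subsetD, assumption, simp)
      then have "p + ?y = p" by simp
      then have "vec_index (p + ?y) (3 * na + c) = vec_index p (3 * na + c)" if "c < ?k" for c
        by simp
      moreover have "vec_index (p + ?y) (3 * na + c) = vec_index p (3 * na + c) + vec_index v c"
        if "c < ?k" for c
        using that v p n by simp
      ultimately show "v = 0\<^sub>v ?k"
        using v by (intro eq_vecI) simp_all
    qed
  next
    assume ker: "\<forall>v\<in>carrier_vec ?k. ?P v"
    have "q = p" if q: "q \<in> carrier_vec (3 * n)" and anchors: "\<forall>i\<in>{1..na}. pos q i = pos p i"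
      and disp: "\<forall>t\<in>X. displacement \<mu> q t = 0" for q
    proof -
      let ?v = "vec_last (q - p) ?k"
      have qp: "q - p \<in> carrier_vec (3 * n)"
        using p q by simp
      have "vec_first (q - p) (3 * na) = 0\<^sub>v (3 * na)"
        using anchor_coordinates[OF anchors] p q n
        by (intro eq_vecI) (auto simp: vec_first_def)
      then have split: "q - p = 0\<^sub>v (3 * na) @\<^sub>v ?v"
        using vec_first_last_append[of "q - p" "3 * na" ?k] qp n by simp
      have pq: "p + (q - p) = q"
        using p q by (intro eq_vecI) auto
      then have "\<forall>t\<in>X. displacement \<mu> (q - p) t = 0"
        using disp disp_add[OF qp] by simp
      then have "?v = 0\<^sub>v ?k"
        using ker split vec_last_carrier[of "q - p" ?k] by metis
      then have "q - p = 0\<^sub>v (3 * n)"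
        using split n by (auto intro!: eq_vecI)
      then show "q = p"
        using pq p by simp
    qed
    then show "localizable n na X \<mu> p"
      unfolding localizable_def using p disp_p by auto
  qed
qed

section \<open>The rows of the rigidity matrix\<close>

text \<open>Collects what the main argument uses about stacking and differentiation, independently
  of the row order. An angle row is described on the free columns only, where its derivatives
  vanish; a displacement row reproduces its linear form.\<close>

lemma rigidity_matrix_rows:
  fixes \<mu> :: "tuple5 \<Rightarrow> real ^ 4"
  assumes graph: "undirected_graph n E" and na: "na \<le> n" and p: "p \<in> carrier_vec (3 * n)"
    and X: "X \<subseteq> displacement_tuples E"
  defines "R \<equiv> rigidity_matrix na E X \<mu> p"
  shows "dim_col R = 3 * n"
    and "\<And>r. r < dim_row R \<Longrightarrow>
      (\<forall>c\<in>{3 * na..<3 * n}. R $$ (r, c) = 0) \<or>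
      (\<exists>t\<in>X. \<exists>s. \<forall>x\<in>carrier_vec (3 * n). vec_index (R *\<^sub>v x) r = displacement \<mu> x t $ s)"
    and "\<And>t s. t \<in> X \<Longrightarrow>
      \<exists>r<dim_row R. \<forall>x\<in>carrier_vec (3 * n). vec_index (R *\<^sub>v x) r = displacement \<mu> x t $ s"
proof -
  \<comment> \<open>The lists contain functions instead of values, so that a row index selects one
    component function for all \<open>x\<close> at once.\<close>
  define as where "as = map (\<lambda>t x. angle_value p x t) (enumeration (angle_triples na E))"
  define ds where "ds = concat (map (\<lambda>t. [\<lambda>x. displacement \<mu> x t $ 1, \<lambda>x. displacement \<mu> x t $ 2,
    \<lambda>x. displacement \<mu> x t $ 3]) (enumeration X))"
  let ?f = "angle_displacement_function na E X \<mu> p"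
  let ?N = "length (as @ ds)"
  have f: "?f x = vec_of_list (map (\<lambda>g. g x) (as @ ds))" for x
    by (simp add: angle_displacement_function_def as_def ds_def map_concat comp_def)
  have dim_f: "dim_vec (?f x) = ?N" for x
    by (simp add: f)
  have f_index: "vec_index (?f x) r = ((as @ ds) ! r) x" if "r < ?N" for x r
    using that unfolding f vec_of_list_index by (simp only: length_map nth_map)
  have E: "finite E" "E \<subseteq> {1..n} \<times> {1..n}"
    using graph by (auto simp: undirected_graph_def intro: finite_subset)
  \<comment> \<open>\<open>enumeration\<close> is a choice, known to list its set only when that set
    is finite; hence the bounding boxes here and for \<open>X\<close>.\<close>
  have "angle_triples na E \<subseteq> {1..na} \<times> {1..na} \<times> {1..na}"
    by (auto simp: angle_triples_def)
  then have as: "set as = (\<lambda>t x. angle_value p x t) ` angle_triples na E"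
    by (auto simp: as_def set_enumeration finite_subset)
  have "X \<subseteq> {1..n} \<times> {1..n} \<times> {1..n} \<times> {1..n} \<times> {1..n}"
    using X E by (force simp: displacement_tuples_def)
  then have "finite X"
    by (rule finite_subset) simp
  then have "set ds = (\<Union>t\<in>X. range (\<lambda>s x. displacement \<mu> x t $ s))"
    by (simp add: ds_def set_enumeration UNIV_3)
  then have ds: "set ds = {\<lambda>x. displacement \<mu> x t $ s | t s. t \<in> X}"
    by (simp only:) blast
  have R: "R = jacobian ?f p"
    by (simp add: R_def rigidity_matrix_def)
  have dim_R: "dim_row R = ?N" "dim_col R = 3 * n"
    using p by (auto simp: R jacobian_def dim_f)
  show "dim_col R = 3 * n"
    by (rule dim_R)
  have disp: "\<forall>x\<in>carrier_vec (3 * n). vec_index (R *\<^sub>v x) r = displacement \<mu> x t $ s"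
    if "r < ?N" "t \<in> X" "(as @ ds) ! r = (\<lambda>x. displacement \<mu> x t $ s)" for r t s
  proof -
    have fr: "(\<lambda>x. vec_index (?f x) r) = (\<lambda>x. displacement \<mu> x t $ s)"
      using that f_index by auto
    have "linear_form (3 * n) (\<lambda>x. vec_index (?f x) r)"
      unfolding fr by (rule linear_form_displacement[OF graph subsetD[OF X that(2)]])
    with that(1) have "vec_index (R *\<^sub>v x) r = vec_index (?f x) r" if "x \<in> carrier_vec (3 * n)" for x
      unfolding R using that by (intro jacobian_linear_row[OF p]) (simp_all only: dim_f)
    then show ?thesis
      using fun_cong[OF fr] by simp
  qed
  show "(\<forall>c\<in>{3 * na..<3 * n}. R $$ (r, c) = 0) \<or>
      (\<exists>t\<in>X. \<exists>s. \<forall>x\<in>carrier_vec (3 * n). vec_index (R *\<^sub>v x) r = displacement \<mu> x t $ s)"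
    if r: "r < dim_row R" for r
  proof -
    have rN: "r < ?N"
      using r dim_R by simp
    then have "(as @ ds) ! r \<in> set as \<union> set ds"
      by (metis nth_mem set_append)
    then consider t where "t \<in> angle_triples na E" "(as @ ds) ! r = (\<lambda>x. angle_value p x t)"
      | t s where "t \<in> X" "(as @ ds) ! r = (\<lambda>x. displacement \<mu> x t $ s)"
      unfolding as ds by blast
    then show ?thesis
    proof cases
      case 1
      have "R $$ (r, c) = 0" if c: "c \<in> {3 * na..<3 * n}" for c
      proof -
        \<comment> \<open>Varying a free coordinate leaves the angle value constant, so the partial
          derivative is zero.\<close>
        have "(\<lambda>s. vec_index (?f (p |\<^sub>v c \<mapsto> s)) r) = (\<lambda>s. angle_value p p t)"
          using 1 c p na rN by (auto simp: f_index angle_value_update_vec)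
        then show ?thesis
          using c p rN dim_f by (simp add: R jacobian_def)
      qed
      then show ?thesis by blast
    next
      case 2
      then show ?thesis
        using disp[OF rN] by blast
    qed
  qed
  show "\<exists>r<dim_row R. \<forall>x\<in>carrier_vec (3 * n). vec_index (R *\<^sub>v x) r = displacement \<mu> x t $ s"
    if t: "t \<in> X" for t s
  proof -
    have "(\<lambda>x. displacement \<mu> x t $ s) \<in> set (as @ ds)"
      unfolding set_append ds using t by blast
    then obtain r where r: "r < ?N" "(as @ ds) ! r = (\<lambda>x. displacement \<mu> x t $ s)"
      unfolding in_set_conv_nth by blast
    then show ?thesis
      using disp[OF r(1) t r(2)] dim_R(1) by auto
  qed
qed

section \<open>Nonsingularity of the free block and the position formula\<close>

theorem theorem4:
  fixes n na :: nat
    and E :: graph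
    and m :: measurement
    and X :: "tuple5 set"
    and \<mu> :: "tuple5 \<Rightarrow> real ^ 4"
    and p :: "real Matrix.vec"
  defines "D \<equiv> information_matrix na E X \<mu> p"
  assumes anchors: "na \<le> n"
    and graph: "undirected_graph n E"
    and configuration: "p \<in> carrier_vec (3 * n)"
    and constraints: "displacement_data m E X \<mu> p"
    and not_collocated: "inj_on (pos p) {1..n}"
    and anchor_degree: "\<And>i. i \<in> {1..na} \<Longrightarrow> card (neighbors E i \<inter> {1..na}) \<ge> 2"
    and free_degree: "\<And>i. i \<in> {na + 1..n} \<Longrightarrow> card (neighbors E i) \<ge> 4"
    and not_collinear: "\<And>i. m \<in> {Relative_Bearing, Angle} \<Longrightarrow> i \<in> {na + 1..n} \<Longrightarrow>
           \<not> collinear (pos p ` insert i (neighbors E i))"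
  shows "(localizable n na X \<mu> p \<longleftrightarrow> invertible_mat (block_ff na D)) \<and>
         (localizable n na X \<mu> p \<longrightarrow>
            vec_last p (3 * (n - na)) =
              (- the (mat_inverse (block_ff na D)) * block_fa na D) *\<^sub>v vec_first p (3 * na))"
proof -
  define R where "R = rigidity_matrix na E X \<mu> p"
  define k where "k = 3 * (n - na)"
  have n: "3 * n = 3 * na + k"
    using anchors by (simp add: k_def)
  have X: "X \<subseteq> displacement_tuples E" and disp_p: "\<And>t. t \<in> X \<Longrightarrow> displacement \<mu> p t = 0"
    using constraints by (auto simp: displacement_data_def)
  note rows = rigidity_matrix_rows[OF graph anchors configuration X, where \<mu> = \<mu>, folded R_def]
  define N where "N = dim_row R"
  note rows = rows[folded N_def]
  have R: "R \<in> carrier_mat N (3 * na + k)"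
    using rows(1) n by (intro carrier_matI) (simp_all add: N_def)
  have D_eq: "D = transpose_mat R * R"
    by (simp add: D_def information_matrix_def R_def)
  have D_carrier: "D \<in> carrier_mat (3 * na + k) (3 * na + k)"
    unfolding D_eq by (rule mult_carrier_mat[OF transpose_carrier_mat[THEN iffD2, OF R] R])
  note block = block_carrier[OF D_carrier]
  have kernel: "R *\<^sub>v (0\<^sub>v (3 * na) @\<^sub>v v) = 0\<^sub>v N \<longleftrightarrow>
      (\<forall>t\<in>X. displacement \<mu> (0\<^sub>v (3 * na) @\<^sub>v v) t = 0)" if v: "v \<in> carrier_vec k" for v
  proof -
    let ?x = "0\<^sub>v (3 * na) @\<^sub>v v"
    have x: "?x \<in> carrier_vec (3 * n)"
      using v n by auto
    show ?thesis
    proof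
      assume Rx: "R *\<^sub>v ?x = 0\<^sub>v N"
      have "displacement \<mu> ?x t $ s = 0" if "t \<in> X" for t s
        using rows(3)[OF that, of s] x Rx by auto
      then show "\<forall>t\<in>X. displacement \<mu> ?x t = 0"
        by (simp add: Finite_Cartesian_Product.vec_eq_iff)
    next
      assume ker: "\<forall>t\<in>X. displacement \<mu> ?x t = 0"
      show "R *\<^sub>v ?x = 0\<^sub>v N"
      proof (rule eq_vecI)
        fix r assume "r < dim_vec (0\<^sub>v N :: real Matrix.vec)"
        then have r: "r < N" and Rr: "r < dim_row R" by (simp_all add: N_def)
        from rows(2)[OF r] show "vec_index (R *\<^sub>v ?x) r = vec_index (0\<^sub>v N) r"
        proof
          assume "\<forall>c\<in>{3 * na..<3 * n}. R $$ (r, c) = 0"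
          \<comment> \<open>The row is zero on the free columns and \<open>?x\<close> on the anchor
            columns, so every summand vanishes.\<close>
          then have "scalar_prod (Matrix.row R r) ?x = 0"
            using Rr v rows(1) n unfolding scalar_prod_def by (intro sum.neutral) auto
          then show ?thesis using r Rr by simp
        next
          assume "\<exists>t\<in>X. \<exists>s. \<forall>x\<in>carrier_vec (3 * n). vec_index (R *\<^sub>v x) r = displacement \<mu> x t $ s"
          then obtain t s where "t \<in> X" "vec_index (R *\<^sub>v ?x) r = displacement \<mu> ?x t $ s"
            using x by blast
          then show ?thesis using r ker by (simp del: displacement.simps)
        qed
      qed (simp add: N_def)
    qed
  qed
  \<comment> \<open>Both sides say that a kernel is trivial; \<open>gram_block_kernel\<close> and
    \<open>kernel\<close> identify the two kernels.\<close>
  have iff: "localizable n na X \<mu> p \<longleftrightarrow> invertible_mat (block_ff na D)"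
    unfolding localizable_iff_kernel[OF graph anchors configuration constraints, folded k_def]
      invertible_mat_iff_kernel[OF block(1)]
    by (intro ball_cong refl) (simp only: D_eq gram_block_kernel[OF R] kernel)
  let ?a = "vec_first p (3 * na)" and ?b = "vec_last p k"
  have "vec_last (D *\<^sub>v p) k = 0\<^sub>v k"
  proof (rule eq_vecI)
    fix i assume "i < dim_vec (0\<^sub>v k :: real Matrix.vec)"
    then have i: "i < k" by simp
    \<comment> \<open>These are the summands of entry \<open>3 * na + i\<close> of
      \<open>D p\<close>. The first factor vanishes in an angle row, the second in a displacement
      row because the constraints hold at \<open>p\<close>.\<close>
    have orth: "R $$ (r, 3 * na + i) * vec_index (R *\<^sub>v p) r = 0" if r: "r < N" for r
      using rows(2)[OF r]
    proof
      assume "\<forall>c\<in>{3 * na..<3 * n}. R $$ (r, c) = 0"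
      moreover have "3 * na + i \<in> {3 * na..<3 * n}"
        using i n by simp
      ultimately show ?thesis by (metis mult_zero_left)
    next
      assume "\<exists>t\<in>X. \<exists>s. \<forall>x\<in>carrier_vec (3 * n). vec_index (R *\<^sub>v x) r = displacement \<mu> x t $ s"
      then obtain t s where "t \<in> X" and Rp: "vec_index (R *\<^sub>v p) r = displacement \<mu> p t $ s"
        using configuration by blast
      show ?thesis
        unfolding Rp disp_p[OF \<open>t \<in> X\<close>] by simp
    qed
    have "scalar_prod (Matrix.col R (3 * na + i)) (R *\<^sub>v p)
        = (\<Sum>r<N. R $$ (r, 3 * na + i) * vec_index (R *\<^sub>v p) r)"
      unfolding scalar_prod_def atLeast0LessThan using R i by (intro sum.cong) simp_all
    also have "\<dots> = 0"
      using orth by (intro sum.neutral) simp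
    finally have "scalar_prod (Matrix.col R (3 * na + i)) (R *\<^sub>v p) = 0" .
    moreover have "D *\<^sub>v p = transpose_mat R *\<^sub>v (R *\<^sub>v p)"
      unfolding D_eq using configuration n
      by (intro assoc_mult_mat_vec[OF transpose_carrier_mat[THEN iffD2, OF R] R]) simp
    ultimately show "vec_index (vec_last (D *\<^sub>v p) k) i = vec_index (0\<^sub>v k) i"
      using i rows(1) n by (simp add: vec_last_def)
  qed simp
  moreover have "?a @\<^sub>v ?b = p"
    using configuration n by simp
  ultimately have sum0: "block_fa na D *\<^sub>v ?a + block_ff na D *\<^sub>v ?b = 0\<^sub>v k"
    using block_mult_vec[OF D_carrier, of ?a ?b] by simp
  have "?b = (- the (mat_inverse (block_ff na D)) * block_fa na D) *\<^sub>v ?a"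
    if "invertible_mat (block_ff na D)"
  proof -
    let ?I = "the (mat_inverse (block_ff na D))"
    note I = mat_inverse_invertible[OF block(1) that]
    note fa = mult_mat_vec_carrier[OF block(2) vec_first_carrier[of p]]
    note ff = mult_mat_vec_carrier[OF block(1) vec_last_carrier[of p]]
    \<comment> \<open>Applying the left inverse to \<open>sum0\<close> isolates the free positions
      \<open>?b\<close>.\<close>
    have "?I *\<^sub>v (block_ff na D *\<^sub>v ?b) = ?b"
      unfolding assoc_mult_mat_vec[OF I(1) block(1) vec_last_carrier, symmetric] I(2) by simp
    then have "?I *\<^sub>v (block_fa na D *\<^sub>v ?a) + ?b = ?I *\<^sub>v (block_fa na D *\<^sub>v ?a + block_ff na D *\<^sub>v ?b)"
      unfolding mult_add_distrib_mat_vec[OF I(1) fa ff] by (simp only:)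
    also have "\<dots> = 0\<^sub>v k"
      unfolding sum0 by (rule mult_mat_zero_vec[OF I(1)])
    finally have zero: "?I *\<^sub>v (block_fa na D *\<^sub>v ?a) + ?b = 0\<^sub>v k" .
    have "?b = - (?I *\<^sub>v (block_fa na D *\<^sub>v ?a))"
    proof (rule eq_vecI)
      fix i assume "i < dim_vec (- (?I *\<^sub>v (block_fa na D *\<^sub>v ?a)))"
      then have i: "i < dim_vec (?I *\<^sub>v (block_fa na D *\<^sub>v ?a))" "i < k"
        using carrier_matD(1)[OF I(1)] by simp_all
      have "vec_index (?I *\<^sub>v (block_fa na D *\<^sub>v ?a)) i + vec_index ?b i = 0"
        using arg_cong[OF zero, of "\<lambda>v. vec_index v i"] i by (simp del: index_mult_mat_vec)
      then show "vec_index ?b i = vec_index (- (?I *\<^sub>v (block_fa na D *\<^sub>v ?a))) i"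
        using i(1) by (simp del: index_mult_mat_vec)
    qed (simp add: carrier_matD(1)[OF I(1)])
    also have "\<dots> = (- ?I * block_fa na D) *\<^sub>v ?a"
      using carrier_matD[OF I(1)] carrier_matD[OF block(2)]
      by (simp add: assoc_mult_mat_vec[OF I(1) block(2)])
    finally show ?thesis .
  qed
  then show ?thesis
    using iff by (simp add: k_def)
qed

end
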